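(* Let $c = c_1 + c_2 \mathbf{i_2} \in \mathbb{BC}$ with $c_1,c_2\in\mathbb{C}(\mathbf{i_1})$, let $P_c(w)=w^2+c$ for $w\in\mathbb{BC}$, and suppose that $\mathcal{K}_{2,c}$ is a bicomplex dendrite. Let $w_1$ be a fixed point of $P_c$ such that $w_1 \in \mathcal{J}_{2,c}$. Then the set $\bigcup_{k=1}^{\infty} P_c^{-k}(w_1)$ is dense in $\mathcal{J}_{2,c}$.
   Context: The bicomplex numbers are $\mathbb{BC}=\{z_1+z_2\mathbf{i_2} \mid z_1,z_2\in\mathbb{C}(\mathbf{i_1})\}$, where $\mathbb{C}(\mathbf{i_1})=\{x+y\mathbf{i_1}\mid x,y\in\mathbb{R}\}$ is the field of complex numbers with imaginary unit $\mathbf{i_1}$; $\mathbf{i_1}^2=\mathbf{i_2}^2=-1$, $\mathbf{i_1}\mathbf{i_2}=\mathbf{i_2}\mathbf{i_1}=\mathbf{j}$, $\mathbf{j}^2=1$. This is a commutative unitary ring, with norm $\|z_1+z_2\mathbf{i_2}\|=\sqrt{|z_1|^2+|z_2|^2}$ and the corresponding (Euclidean) topology. Put $\mathbf{e_1}=\frac{1+\mathbf{j}}{2}$, $\mathbf{e_2}=\frac{1-\mathbf{j}}{2}$; every bicomplex number is uniquely written $z_1+z_2\mathbf{i_2}=(z_1-z_2\mathbf{i_1})\mathbf{e_1}+(z_1+z_2\mathbf{i_1})\mathbf{e_2}$, and addition and multiplication are componentwise in this representation. For nonempty $X_1,X_2\subseteq\mathbb{C}(\mathbf{i_1})$, the bicomplex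 cartesian set determined by $X_1$ and $X_2$ is $X_1\times_e X_2:=\{w_1\mathbf{e_1}+w_2\mathbf{e_2}\mid w_1\in X_1,\ w_2\in X_2\}\subseteq\mathbb{BC}$. The bicomplex filled-in Julia set is $\mathcal{K}_{2,c}=\{w\in\mathbb{BC}\mid \{P_c^n(w)\}_{n=0}^\infty\text{ is bounded}\}$, where $P_c^n$ is the $n$-th iterate of $P_c$, and the bicomplex Julia set is its boundary $\mathcal{J}_{2,c}=\partial\mathcal{K}_{2,c}$ in $\mathbb{BC}$. For $k\ge1$, $P_c^{-k}(w)=\{v\in\mathbb{BC}\mid P_c^k(v)=w\}$. A dendrite in $\mathbb{C}(\mathbf{i_1})$ is a compact set that is pathwise connected, locally connected, nowhere dense, and does not separate the plane. A bicomplex dendrite is a bicomplex cartesian set $X_1\times_e X_2$ for which both components $X_1$ and $X_2$ are dendrites in $\mathbb{C}(\mathbf{i_1})$. For $a\in\mathbb{C}(\mathbf{i_1})$ let $\mathcal{K}_a=\{z\in\mathbb{C}(\mathbf{i_1})\mid \{P_a^n(z)\}_{n=0}^\infty\text{ is bounded}\}$, where $P_a(z)=z^2+a$; it is known that $\mathcal{K}_{2,c}=\mathcal{K}_{c_1-c_2\mathbf{i_1}}\times_e\mathcal{K}_{c_1+c_2\mathbf{i_1}}$, so $\mathcal{K}_{2,c}$ is a bicomplex dendrite when $\mathcal{K}_{c_1-c_2\mathbf{i_1}}$ and $\mathcal{K}_{c_1+c_2\mathbf{i_1}}$ are dendrites. *)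

theory Defs
  imports "HOL-Analysis.Analysis"
begin

text \<open>\<open>Bicomplex z1 z2\<close> stands for $z_1 + z_2 \mathbf{i_2}$; the type \<^typ>\<open>complex\<close> plays
  the role of $\mathbb{C}(\mathbf{i_1})$.\<close>

datatype bicomplex = Bicomplex (bc1: complex) (bc2: complex)

lemma bicomplex_eq_iff: "w = v \<longleftrightarrow> bc1 w = bc1 v \<and> bc2 w = bc2 v"
  by (cases w; cases v) auto

lemma bicomplex_eqI: "bc1 w = bc1 v \<Longrightarrow> bc2 w = bc2 v \<Longrightarrow> w = v"
  by (simp add: bicomplex_eq_iff)

instantiation bicomplex :: comm_ring_1
begin

definition "0 = Bicomplex 0 0"
definition "1 = Bicomplex 1 0"
definition "w + v = Bicomplex (bc1 w + bc1 v) (bc2 w + bc2 v)"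
definition "- w = Bicomplex (- bc1 w) (- bc2 w)"
definition "w - v = Bicomplex (bc1 w - bc1 v) (bc2 w - bc2 v)"
definition "w * v = Bicomplex (bc1 w * bc1 v - bc2 w * bc2 v) (bc1 w * bc2 v + bc2 w * bc1 v)"

instance
  by standard
    (auto simp: zero_bicomplex_def one_bicomplex_def plus_bicomplex_def uminus_bicomplex_def
      minus_bicomplex_def times_bicomplex_def bicomplex_eq_iff algebra_simps)

end

lemma bicomplex_sel [simp]:
  "bc1 0 = 0" "bc2 0 = 0" "bc1 1 = 1" "bc2 1 = 0"
  "bc1 (w + v) = bc1 w + bc1 v" "bc2 (w + v) = bc2 w + bc2 v"
  "bc1 (- w) = - bc1 w" "bc2 (- w) = - bc2 w"
  "bc1 (w - v) = bc1 w - bc1 v" "bc2 (w - v) = bc2 w - bc2 v"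
  "bc1 (w * v) = bc1 w * bc1 v - bc2 w * bc2 v"
  "bc2 (w * v) = bc1 w * bc2 v + bc2 w * bc1 v"
  by (simp_all add: zero_bicomplex_def one_bicomplex_def plus_bicomplex_def
      uminus_bicomplex_def minus_bicomplex_def times_bicomplex_def)

instantiation bicomplex :: real_algebra_1
begin

definition "r *\<^sub>R w = Bicomplex (r *\<^sub>R bc1 w) (r *\<^sub>R bc2 w)"

instance
  by standard (auto simp: scaleR_bicomplex_def bicomplex_eq_iff algebra_simps)

end

lemma bicomplex_sel_scaleR [simp]:
  "bc1 (r *\<^sub>R w) = r *\<^sub>R bc1 w" "bc2 (r *\<^sub>R w) = r *\<^sub>R bc2 w"
  by (simp_all add: scaleR_bicomplex_def)

text \<open>This norm is not submultiplicative (only up to the factor $\sqrt 2$), so the type is not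
  an instance of \<^class>\<open>real_normed_algebra\<close>.\<close>

instantiation bicomplex :: real_normed_vector
begin

definition "norm w = sqrt ((cmod (bc1 w))\<^sup>2 + (cmod (bc2 w))\<^sup>2)"
definition sgn_bicomplex_def: "sgn (w :: bicomplex) = w /\<^sub>R norm w"
definition dist_bicomplex_def: "dist (w :: bicomplex) v = norm (w - v)"
definition uniformity_bicomplex_def:
  "(uniformity :: (bicomplex \<times> bicomplex) filter) =
     (INF e\<in>{0 <..}. principal {(x, y). dist x y < e})"
definition open_bicomplex_def:
  "open (U :: bicomplex set) \<longleftrightarrow>
     (\<forall>x\<in>U. eventually (\<lambda>(x', y). x' = x \<longrightarrow> y \<in> U) uniformity)"

instance
proof
  fix r :: real and w v :: bicomplex and U :: "bicomplex set"
  show "(norm w = 0) = (w = 0)"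
    by (simp add: norm_bicomplex_def bicomplex_eq_iff sum_power2_eq_zero_iff)
  show "norm (w + v) \<le> norm w + norm v"
  proof -
    have "norm (w + v) \<le>
        sqrt ((cmod (bc1 w) + cmod (bc1 v))\<^sup>2 + (cmod (bc2 w) + cmod (bc2 v))\<^sup>2)"
      by (auto simp: norm_bicomplex_def intro!: add_mono power_mono norm_triangle_ineq)
    also have "\<dots> \<le> norm w + norm v"
      unfolding norm_bicomplex_def by (rule real_sqrt_sum_squares_triangle_ineq)
    finally show ?thesis .
  qed
  show "norm (r *\<^sub>R w) = \<bar>r\<bar> * norm w"
    by (simp add: norm_bicomplex_def power_mult_distrib real_sqrt_mult
        flip: distrib_left)
qed (rule sgn_bicomplex_def dist_bicomplex_def uniformity_bicomplex_def open_bicomplex_def)+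

end

definition bc_of_complex :: "complex \<Rightarrow> bicomplex" where
  "bc_of_complex z = Bicomplex z 0"

definition bc_i1 :: bicomplex where "bc_i1 = bc_of_complex \<i>"
definition bc_i2 :: bicomplex where "bc_i2 = Bicomplex 0 1"
definition bc_j :: bicomplex where "bc_j = bc_i1 * bc_i2"
definition bc_e1 :: bicomplex where "bc_e1 = (1 + bc_j) /\<^sub>R 2"
definition bc_e2 :: bicomplex where "bc_e2 = (1 - bc_j) /\<^sub>R 2"

lemmas bicomplex_unit_defs =
  bc_of_complex_def bc_i1_def bc_i2_def bc_j_def bc_e1_def bc_e2_def

lemma bicomplex_units:
  "bc_i1 * bc_i1 = - 1" "bc_i2 * bc_i2 = - 1" "bc_j * bc_j = 1"
  by (simp_all add: bicomplex_unit_defs bicomplex_eq_iff)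

lemma Bicomplex_eq: "Bicomplex z1 z2 = bc_of_complex z1 + bc_of_complex z2 * bc_i2"
  by (simp add: bicomplex_unit_defs bicomplex_eq_iff)

lemma bicomplex_idempotent_repr:
  "Bicomplex z1 z2 = bc_of_complex (z1 - z2 * \<i>) * bc_e1 + bc_of_complex (z1 + z2 * \<i>) * bc_e2"
  by (simp add: bicomplex_unit_defs bicomplex_eq_iff complex_eq_iff field_simps)

definition bc_cartesian :: "complex set \<Rightarrow> complex set \<Rightarrow> bicomplex set"
    (infixr \<open>\<times>\<^sub>e\<close> 80) where
  "X1 \<times>\<^sub>e X2 = {bc_of_complex w1 * bc_e1 + bc_of_complex w2 * bc_e2 | w1 w2. w1 \<in> X1 \<and> w2 \<in> X2}"

definition dendrite :: "complex set \<Rightarrow> bool" where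
  "dendrite X \<longleftrightarrow> compact X \<and> path_connected X \<and> locally connected X \<and>
     interior (closure X) = {} \<and> connected (- X)"

text \<open>Cartesian sets are only formed from nonempty components.\<close>

definition bicomplex_dendrite :: "bicomplex set \<Rightarrow> bool" where
  "bicomplex_dendrite W \<longleftrightarrow>
     (\<exists>X1 X2. X1 \<noteq> {} \<and> X2 \<noteq> {} \<and> W = X1 \<times>\<^sub>e X2 \<and> dendrite X1 \<and> dendrite X2)"

text \<open>The definitions are generic so that over \<^typ>\<open>complex\<close> they give the usual sets in the plane.\<close>

definition quad_poly :: "'a \<Rightarrow> 'a \<Rightarrow> 'a::comm_ring_1" where
  "quad_poly c w = w\<^sup>2 + c"

definition filled_julia :: "'a \<Rightarrow> 'a::{comm_ring_1, metric_space} set" where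
  "filled_julia c = {w. bounded (range (\<lambda>n. (quad_poly c ^^ n) w))}"

definition julia :: "'a \<Rightarrow> 'a::{comm_ring_1, metric_space} set" where
  "julia c = frontier (filled_julia c)"

definition dense_in :: "'a::topological_space set \<Rightarrow> 'a set \<Rightarrow> bool" where
  "dense_in A S \<longleftrightarrow> A \<subseteq> S \<and> S \<subseteq> closure A"

end

(* In idempotent coordinates P_c splits into two complex quadratic polynomials, and since w1 is
   fixed its backward orbit is an increasing union, hence the product of the backward orbits of
   the two coordinates.  In the plane, let u be a nonzero fixed point of P_a and suppose that a
   disc around a point z of the filled Julia set misses the backward orbit of u.  Then every
   iterate of P_a omits the two values u and -u on this disc, while the orbit of z is bounded, so
   Schottky's theorem bounds all iterates uniformly on a smaller disc.  This disc therefore lies in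
   the filled Julia set, which has empty interior: a contradiction. *)

theory Submission
  imports Defs "HOL-Complex_Analysis.Great_Picard"
begin

section \<open>Backward orbits in the plane\<close>

text \<open>Serves to exclude the parameter 0, the only one for which 0 is a fixed point.\<close>

lemma ball_subset_filled_julia_0: "ball 0 1 \<subseteq> filled_julia (0 :: complex)"
proof
  fix z :: complex
  assume "z \<in> ball 0 1"
  then have z: "cmod z \<le> 1" by simp
  have "cmod ((quad_poly 0 ^^ n) z) \<le> 1" for n
    by (induction n) (use z in \<open>auto simp: quad_poly_def norm_power power_le_one\<close>)
  then show "z \<in> filled_julia 0"
    unfolding filled_julia_def by (auto intro!: boundedI[where B = 1])
qed

lemma holomorphic_quad_poly_funpow: "(quad_poly a ^^ n) holomorphic_on S"
  by (induction n) (auto simp: quad_poly_def o_def intro!: holomorphic_intros)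

text \<open>Rescaling \<open>x \<mapsto> z + r * x\<close> moves Schottky's theorem from the unit
  disc to \<open>cball z r\<close>. At radius 1/2 its term \<open>12 * (1/2) / (1 - 1/2)\<close> is
  12, whence the 14. The bound depends on \<open>B\<close> alone, not on \<open>f\<close>, so it can
  hold for all iterates at once.\<close>

lemma Schottky_cball:
  assumes "f holomorphic_on cball z r" and "r > 0" and "norm (f z) \<le> B"
    and "\<And>y. y \<in> cball z r \<Longrightarrow> f y \<noteq> 0 \<and> f y \<noteq> 1"
    and "norm (y - z) \<le> r / 2"
  shows "norm (f y) \<le> exp (pi * exp (pi * (14 + 2 * B)))"
proof -
  define g where "g = (\<lambda>x. f (z + of_real r * x))"
  have sub: "z + of_real r * x \<in> cball z r" if "x \<in> cball 0 1" for x
    using that \<open>r > 0\<close> by (simp add: dist_norm norm_mult)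
  have "(f \<circ> (\<lambda>x. z + of_real r * x)) holomorphic_on cball 0 1"
    by (rule holomorphic_on_compose_gen[OF _ assms(1)])
       (use sub in \<open>auto intro!: holomorphic_intros\<close>)
  then have "g holomorphic_on cball 0 1"
    by (simp add: g_def o_def)
  moreover have "norm (g 0) \<le> B"
    using assms(3) by (simp add: g_def)
  moreover have "\<not> (g x = 0 \<or> g x = 1)" if "x \<in> cball 0 1" for x
    using assms(4)[OF sub[OF that]] by (simp add: g_def)
  moreover have "norm ((y - z) / of_real r) \<le> 1 / 2"
    using assms(2,5) by (simp add: norm_divide field_simps)
  ultimately have "norm (g ((y - z) / of_real r)) \<le>
      exp (pi * exp (pi * (2 + 2 * B + 12 * (1/2) / (1 - 1/2))))"
    by (intro Schottky) auto
  then show ?thesis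
    using \<open>r > 0\<close> by (simp add: g_def)
qed

lemma filled_julia_subset_closure_preimages:
  fixes a u :: complex
  assumes int: "interior (filled_julia a) = {}" and u: "quad_poly a u = u"
  shows "filled_julia a \<subseteq> closure (\<Union>k\<in>{1..}. (quad_poly a ^^ k) -` {u})"
    (is "_ \<subseteq> closure ?O")
proof
  fix z assume z: "z \<in> filled_julia a"
  \<comment> \<open>The omitted values \<open>u\<close> and \<open>- u\<close> must be distinct, and
    \<open>u = 0\<close> would force \<open>a = 0\<close>.\<close>
  have "a \<noteq> 0"
  proof
    assume "a = 0"
    then have "ball 0 1 \<subseteq> interior (filled_julia a)"
      using ball_subset_filled_julia_0 by (intro interior_maximal) auto
    then show False using int by simp
  qed
  then have u0: "u \<noteq> 0"
    using u by (auto simp: quad_poly_def)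
  show "z \<in> closure ?O"
  proof (rule ccontr)
    assume "z \<notin> closure ?O"
    then obtain r where r: "r > 0" "cball z r \<subseteq> - closure ?O"
      using open_contains_cball[of "- closure ?O"] by auto
    \<comment> \<open>The affine change of coordinate that sends \<open>- u\<close> to 0 and
      \<open>u\<close> to 1, the values omitted in Schottky's theorem.\<close>
    define f where "f = (\<lambda>n y. ((quad_poly a ^^ n) y + u) / (2 * u))"
    obtain B where B: "\<And>n. cmod ((quad_poly a ^^ n) z) \<le> B"
      using z unfolding filled_julia_def bounded_iff by auto
    have omit: "f n y \<noteq> 0 \<and> f n y \<noteq> 1" if y: "y \<in> cball z r" for n y
    proof -
      have "y \<notin> ?O"
        using y r closure_subset[of ?O] by blast
      \<comment> \<open>The polynomial is even, so one more application sends both \<open>u\<close>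
        and \<open>- u\<close> to \<open>u\<close>. The index \<open>Suc n\<close> is at least 1, as
        the union requires, so \<open>n = 0\<close> is covered too.\<close>
      then have "(quad_poly a ^^ Suc n) y \<noteq> u"
        by (auto simp del: funpow.simps)
      then have "(quad_poly a ^^ n) y \<noteq> u" "(quad_poly a ^^ n) y \<noteq> - u"
        using u by (auto simp: quad_poly_def)
      then show ?thesis
        using u0 by (auto simp: f_def field_simps eq_neg_iff_add_eq_0)
    qed
    \<comment> \<open>Bounds \<open>f n z\<close> for every \<open>n\<close>, because the orbit of
      \<open>z\<close> stays within \<open>B\<close>; hence \<open>M\<close> does not depend on
      \<open>n\<close> either.\<close>
    define C where "C = (B + cmod u) / (2 * cmod u)"
    define M where "M = exp (pi * exp (pi * (14 + 2 * C)))"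
    have fM: "cmod (f n y) \<le> M" if "y \<in> ball z (r / 2)" for n y
      unfolding M_def
    proof (rule Schottky_cball[of "f n" z r])
      show "f n holomorphic_on cball z r"
        unfolding f_def using u0
        by (intro holomorphic_intros holomorphic_quad_poly_funpow) auto
      have "cmod ((quad_poly a ^^ n) z + u) \<le> B + cmod u"
        by (meson B norm_triangle_ineq order_trans add_right_mono)
      then show "cmod (f n z) \<le> C"
        by (simp add: f_def C_def norm_divide norm_mult divide_right_mono)
    qed (use r omit that in \<open>auto simp: dist_norm norm_minus_commute\<close>)
    have "ball z (r / 2) \<subseteq> filled_julia a"
    proof
      fix y assume y: "y \<in> ball z (r / 2)"
      have "cmod ((quad_poly a ^^ n) y) \<le> 2 * cmod u * M + cmod u" for n
      proof -
        have "(quad_poly a ^^ n) y = 2 * u * f n y - u"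
          using u0 by (simp add: f_def)
        also have "cmod \<dots> \<le> cmod (2 * u * f n y) + cmod u"
          by (rule norm_triangle_ineq4)
        also have "\<dots> \<le> 2 * cmod u * M + cmod u"
          using fM[OF y, of n] by (simp add: norm_mult mult_left_mono)
        finally show ?thesis .
      qed
      then show "y \<in> filled_julia a"
        unfolding filled_julia_def by (auto intro!: boundedI)
    qed
    then have "ball z (r / 2) \<subseteq> interior (filled_julia a)"
      by (intro interior_maximal) auto
    then show False
      using int r(1) by auto
  qed
qed

section \<open>Idempotent coordinates\<close>

text \<open>The coefficient of \<open>bc_e1\<close>; \<open>idem2\<close> is that of
  \<open>bc_e2\<close>. Both are ring homomorphisms onto the complex numbers.\<close>

definition idem1 :: "bicomplex \<Rightarrow> complex" where
  "idem1 w = bc1 w - bc2 w * \<i>"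

definition idem2 :: "bicomplex \<Rightarrow> complex" where
  "idem2 w = bc1 w + bc2 w * \<i>"

text \<open>Takes a pair, so that cartesian sets become linear images of ordinary products and
  inherit their topology.\<close>

definition idem_pair :: "complex \<times> complex \<Rightarrow> bicomplex" where
  "idem_pair p = bc_of_complex (fst p) * bc_e1 + bc_of_complex (snd p) * bc_e2"

lemma idem_idem_pair [simp]: "idem1 (idem_pair p) = fst p" "idem2 (idem_pair p) = snd p"
  by (simp_all add: idem1_def idem2_def idem_pair_def bicomplex_unit_defs complex_eq_iff)

lemma idem_pair_idem [simp]: "idem_pair (idem1 w, idem2 w) = w"
  using bicomplex_idempotent_repr[of "bc1 w" "bc2 w"]
  by (simp add: idem_pair_def idem1_def idem2_def)

lemma idem_eq_iff: "w = v \<longleftrightarrow> idem1 w = idem1 v \<and> idem2 w = idem2 v"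
  by (metis idem_pair_idem[of w] idem_pair_idem[of v])

lemma bc_cartesian_eq_image: "X1 \<times>\<^sub>e X2 = idem_pair ` (X1 \<times> X2)"
  by (auto simp: bc_cartesian_def idem_pair_def image_iff; blast)

lemma bc_cartesian_iff: "w \<in> X1 \<times>\<^sub>e X2 \<longleftrightarrow> idem1 w \<in> X1 \<and> idem2 w \<in> X2"
  by (auto simp: bc_cartesian_eq_image intro!: image_eqI[where x = "(idem1 w, idem2 w)"])

text \<open>Identifies the unspecified components in \<open>bicomplex_dendrite\<close> with the
  filled Julia sets of the two coordinates.\<close>

lemma bc_cartesian_inject:
  assumes "X1 \<times>\<^sub>e X2 = Y1 \<times>\<^sub>e Y2" and "X1 \<noteq> {}" and "X2 \<noteq> {}"
  shows "X1 = Y1" and "X2 = Y2"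
proof -
  have "(x, y) \<in> X1 \<times> X2 \<longleftrightarrow> (x, y) \<in> Y1 \<times> Y2" for x y
    using assms(1) bc_cartesian_iff[of "idem_pair (x, y)"] by auto
  with assms(2,3) show "X1 = Y1" "X2 = Y2" by auto
qed

text \<open>The parallelogram law for \<open>bc1 w\<close> and \<open>bc2 w * \<i>\<close>.\<close>

lemma norm_idem: "(cmod (idem1 w))\<^sup>2 + (cmod (idem2 w))\<^sup>2 = 2 * (norm w)\<^sup>2"
  unfolding norm_bicomplex_def idem1_def idem2_def
  by (simp add: cmod_power2) (simp add: power2_eq_square algebra_simps)

lemma norm_idem_le: "cmod (idem1 w) \<le> 2 * norm w" "cmod (idem2 w) \<le> 2 * norm w"
proof -
  have "2 * (norm w)\<^sup>2 \<le> (2 * norm w)\<^sup>2"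
    by (simp add: power_mult_distrib)
  then have "(cmod (idem1 w))\<^sup>2 \<le> (2 * norm w)\<^sup>2" "(cmod (idem2 w))\<^sup>2 \<le> (2 * norm w)\<^sup>2"
    using norm_idem[of w] zero_le_power2[of "cmod (idem1 w)"] zero_le_power2[of "cmod (idem2 w)"]
    by linarith+
  then show "cmod (idem1 w) \<le> 2 * norm w" "cmod (idem2 w) \<le> 2 * norm w"
    by (auto intro: power2_le_imp_le)
qed

lemma bounded_linear_idem1: "bounded_linear idem1"
  by (rule bounded_linear_intro[where K = 2])
     (use norm_idem_le in \<open>auto simp: idem1_def algebra_simps\<close>)

lemma bounded_linear_idem2: "bounded_linear idem2"
  by (rule bounded_linear_intro[where K = 2])
     (use norm_idem_le in \<open>auto simp: idem2_def algebra_simps\<close>)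

lemma bounded_linear_idem_pair: "bounded_linear idem_pair"
proof (rule bounded_linear_intro[where K = 1])
  fix p q :: "complex \<times> complex" and r :: real
  show "idem_pair (p + q) = idem_pair p + idem_pair q"
    by (simp add: idem_pair_def bicomplex_unit_defs bicomplex_eq_iff algebra_simps)
  show "idem_pair (r *\<^sub>R p) = r *\<^sub>R idem_pair p"
    by (simp add: idem_pair_def bicomplex_unit_defs bicomplex_eq_iff algebra_simps)
  have "2 * (norm (idem_pair p))\<^sup>2 = (norm p)\<^sup>2"
    using norm_idem[of "idem_pair p"] by (simp add: norm_prod_def)
  then have "(norm (idem_pair p))\<^sup>2 \<le> (norm p)\<^sup>2"
    using zero_le_power2[of "norm (idem_pair p)"] by linarith
  then show "norm (idem_pair p) \<le> norm p * 1"
    by (auto intro: power2_le_imp_le)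
qed

section \<open>Boundedness, closure, compactness and interior in idempotent coordinates\<close>

lemma bounded_bicomplex_iff: "bounded S \<longleftrightarrow> bounded (idem1 ` S) \<and> bounded (idem2 ` S)"
proof
  assume "bounded (idem1 ` S) \<and> bounded (idem2 ` S)"
  then have "bounded (idem_pair ` (idem1 ` S \<times> idem2 ` S))"
    by (intro bounded_linear_image[OF _ bounded_linear_idem_pair] bounded_Times) auto
  moreover have "S \<subseteq> idem_pair ` (idem1 ` S \<times> idem2 ` S)"
    unfolding bc_cartesian_eq_image[symmetric] by (auto simp: bc_cartesian_iff)
  ultimately show "bounded S"
    by (rule bounded_subset)
qed (simp add: bounded_linear_image bounded_linear_idem1 bounded_linear_idem2)

lemma closure_bc_cartesian_superset: "closure X1 \<times>\<^sub>e closure X2 \<subseteq> closure (X1 \<times>\<^sub>e X2)"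
  unfolding bc_cartesian_eq_image closure_Times[symmetric]
  by (rule image_closure_subset)
     (auto intro: closure_subset[THEN subsetD] linear_continuous_on bounded_linear_idem_pair)

lemma compact_bc_cartesian: "compact X1 \<Longrightarrow> compact X2 \<Longrightarrow> compact (X1 \<times>\<^sub>e X2)"
  unfolding bc_cartesian_eq_image
  by (intro compact_continuous_image compact_Times linear_continuous_on bounded_linear_idem_pair)

text \<open>Freezing the second coordinate of an interior point would leave a nonempty open slice
  inside \<open>X1\<close>.\<close>

lemma interior_bc_cartesian_empty:
  assumes "interior X1 = {}"
  shows "interior (X1 \<times>\<^sub>e X2) = {}"
proof (rule ccontr)
  assume "interior (X1 \<times>\<^sub>e X2) \<noteq> {}"
  then obtain w where w: "w \<in> interior (X1 \<times>\<^sub>e X2)" by auto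
  define U where "U = (\<lambda>z. idem_pair (z, idem2 w)) -` interior (X1 \<times>\<^sub>e X2)"
  have "continuous_on UNIV (\<lambda>z. idem_pair (z, idem2 w))"
    by (intro bounded_linear.continuous_on[OF bounded_linear_idem_pair] continuous_intros)
  then have "open U"
    unfolding U_def by (rule open_vimage[OF open_interior])
  moreover have "U \<subseteq> X1"
    using interior_subset[of "X1 \<times>\<^sub>e X2"] by (auto simp: U_def bc_cartesian_iff dest!: subsetD)
  ultimately have "U \<subseteq> interior X1"
    by (rule interior_maximal[rotated])
  moreover have "idem1 w \<in> U"
    using w by (simp add: U_def)
  ultimately show False
    using assms by auto
qed

section \<open>Quadratic dynamics in idempotent coordinates\<close>

lemma idem_quad_poly:
  "idem1 (quad_poly c w) = quad_poly (idem1 c) (idem1 w)"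
  "idem2 (quad_poly c w) = quad_poly (idem2 c) (idem2 w)"
  by (simp_all add: idem1_def idem2_def quad_poly_def power2_eq_square algebra_simps)

lemma idem_quad_poly_funpow:
  "idem1 ((quad_poly c ^^ n) w) = (quad_poly (idem1 c) ^^ n) (idem1 w)"
  "idem2 ((quad_poly c ^^ n) w) = (quad_poly (idem2 c) ^^ n) (idem2 w)"
  by (induction n) (simp_all add: idem_quad_poly)

text \<open>Iteration acts coordinatewise, and a bicomplex orbit is bounded exactly when both
  coordinate orbits are.\<close>

lemma filled_julia_bicomplex: "filled_julia c = filled_julia (idem1 c) \<times>\<^sub>e filled_julia (idem2 c)"
  by (auto simp: filled_julia_def bc_cartesian_iff bounded_bicomplex_iff image_image
      idem_quad_poly_funpow)

lemma funpow_vimage_bicomplex: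
  "(quad_poly c ^^ k) -` {w} =
    (quad_poly (idem1 c) ^^ k) -` {idem1 w} \<times>\<^sub>e (quad_poly (idem2 c) ^^ k) -` {idem2 w}"
  by (auto simp: bc_cartesian_iff idem_quad_poly_funpow idem_eq_iff)

section \<open>Preimages of a fixed point\<close>

lemma funpow_fixed_point: "f x = x \<Longrightarrow> (f ^^ n) x = x"
  by (induction n) auto

text \<open>An orbit that has reached the fixed point stays there. This lets two different hitting
  times be replaced by a common one.\<close>

lemma funpow_vimage_fixed_point_mono:
  assumes "f x = x" and "k \<le> n"
  shows "(f ^^ k) -` {x} \<subseteq> (f ^^ n) -` {x}"
proof
  fix y assume "y \<in> (f ^^ k) -` {x}"
  then have "(f ^^ (n - k + k)) y = x"
    using assms(1) by (simp only: funpow_add o_apply vimage_singleton_eq funpow_fixed_point)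
  then show "y \<in> (f ^^ n) -` {x}"
    using assms(2) by simp
qed

lemma funpow_vimage_subset_filled_julia:
  assumes "quad_poly c w = w"
  shows "(quad_poly c ^^ k) -` {w} \<subseteq> filled_julia c"
proof
  fix v assume v: "v \<in> (quad_poly c ^^ k) -` {w}"
  \<comment> \<open>From time \<open>k\<close> on the orbit is constantly \<open>w\<close>, so it
    takes finitely many values.\<close>
  have "(quad_poly c ^^ n) v \<in> insert w ((\<lambda>n. (quad_poly c ^^ n) v) ` {..k})" for n
  proof (cases "n \<le> k")
    case False
    then have "v \<in> (quad_poly c ^^ n) -` {w}"
      using v funpow_vimage_fixed_point_mono[of "quad_poly c" w, OF assms, of k n] by auto
    then show ?thesis by simp
  qed auto
  then have "range (\<lambda>n. (quad_poly c ^^ n) v) \<subseteq> insert w ((\<lambda>n. (quad_poly c ^^ n) v) ` {..k})"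
    by blast
  then have "finite (range (\<lambda>n. (quad_poly c ^^ n) v))"
    by (rule finite_subset) auto
  then show "v \<in> filled_julia c"
    by (simp add: filled_julia_def finite_imp_bounded)
qed

theorem corollary3:
  fixes c w1 :: bicomplex
  assumes "bicomplex_dendrite (filled_julia c)"
    and "quad_poly c w1 = w1"
    and "w1 \<in> julia c"
  shows "dense_in (\<Union>k\<in>{1..}. (quad_poly c ^^ k) -` {w1}) (julia c)"
proof -
  let ?K1 = "filled_julia (idem1 c)" and ?K2 = "filled_julia (idem2 c)"
  let ?O = "\<Union>k\<in>{1..}. (quad_poly c ^^ k) -` {w1}"
  let ?O1 = "\<Union>k\<in>{1..}. (quad_poly (idem1 c) ^^ k) -` {idem1 w1}"
  let ?O2 = "\<Union>k\<in>{1..}. (quad_poly (idem2 c) ^^ k) -` {idem2 w1}"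
  have fp: "quad_poly (idem1 c) (idem1 w1) = idem1 w1" "quad_poly (idem2 c) (idem2 w1) = idem2 w1"
    using assms(2) idem_quad_poly[of c w1] by simp_all
  obtain X1 X2 where X: "X1 \<noteq> {}" "X2 \<noteq> {}" "filled_julia c = X1 \<times>\<^sub>e X2"
      "dendrite X1" "dendrite X2"
    using assms(1) unfolding bicomplex_dendrite_def by blast
  have "X1 \<times>\<^sub>e X2 = ?K1 \<times>\<^sub>e ?K2"
    using X(3) filled_julia_bicomplex[of c] by simp
  with X have "dendrite ?K1" "dendrite ?K2"
    using bc_cartesian_inject[of X1 X2 ?K1 ?K2] by simp_all
  \<comment> \<open>A compact set is its own closure, so nowhere density becomes empty
    interior.\<close>
  then have K: "compact ?K1" "compact ?K2" "interior ?K1 = {}" "interior ?K2 = {}"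
    by (metis dendrite_def compact_imp_closed closure_closed)+
  \<comment> \<open>A closed set with empty interior equals its boundary, so density need only be
    shown in the filled Julia set.\<close>
  have julia: "julia c = filled_julia c"
    using compact_bc_cartesian[OF K(1,2)] interior_bc_cartesian_empty[OF K(3), of ?K2]
    by (simp add: julia_def frontier_def filled_julia_bicomplex[of c] compact_imp_closed
        closure_closed)
  have "?O1 \<times>\<^sub>e ?O2 \<subseteq> ?O"
  proof
    fix v assume "v \<in> ?O1 \<times>\<^sub>e ?O2"
    then obtain k l where kl: "k \<ge> 1" "idem1 v \<in> (quad_poly (idem1 c) ^^ k) -` {idem1 w1}"
      "idem2 v \<in> (quad_poly (idem2 c) ^^ l) -` {idem2 w1}"
      by (auto simp: bc_cartesian_iff)
    \<comment> \<open>The coordinates may hit their fixed points at different times \<open>k\<close>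
      and \<open>l\<close>; a preimage of \<open>w1\<close> needs one common time, and
      \<open>max k l\<close> serves for both.\<close>
    have "idem1 v \<in> (quad_poly (idem1 c) ^^ max k l) -` {idem1 w1}"
      "idem2 v \<in> (quad_poly (idem2 c) ^^ max k l) -` {idem2 w1}"
      using kl funpow_vimage_fixed_point_mono[of "quad_poly (idem1 c)", OF fp(1), of k "max k l"]
        funpow_vimage_fixed_point_mono[of "quad_poly (idem2 c)", OF fp(2), of l "max k l"] by auto
    then have "v \<in> (quad_poly c ^^ max k l) -` {w1}"
      unfolding funpow_vimage_bicomplex bc_cartesian_iff by blast
    with kl(1) show "v \<in> ?O"
      by (intro UN_I[of "max k l"]) auto
  qed
  moreover have "?K1 \<times>\<^sub>e ?K2 \<subseteq> closure ?O1 \<times>\<^sub>e closure ?O2"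
    using filled_julia_subset_closure_preimages[OF K(3) fp(1)]
      filled_julia_subset_closure_preimages[OF K(4) fp(2)]
    by (auto simp only: bc_cartesian_iff subset_iff)
  ultimately have "filled_julia c \<subseteq> closure ?O"
    unfolding filled_julia_bicomplex[of c]
    using closure_bc_cartesian_superset[of ?O1 ?O2] closure_mono by blast
  moreover have "?O \<subseteq> filled_julia c"
    using funpow_vimage_subset_filled_julia[OF assms(2)] by blast
  ultimately show ?thesis
    unfolding dense_in_def julia by blast
qed

end
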